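(* There exists a hyperbolic domain in $\mathbb{C}$ that is a visibility domain and that is not locally Goldilocks at any point of its boundary (i.e. no point of its boundary is a local Goldilocks point).
   Context: For a domain $\Omega\subset\mathbb{C}$, $\mathsf{k}_\Omega$ is the Kobayashi (pseudo)distance and $\kappa_\Omega(z;v)$ the Kobayashi--Royden (pseudo)metric; $\Omega$ is hyperbolic if $\mathsf{k}_\Omega$ is a distance (in the plane, $\mathsf{k}_\Omega$ is then the hyperbolic distance). $\delta_\Omega(z)$ is the Euclidean distance from $z\in\Omega$ to $\partial\Omega$ (boundary in $\mathbb{C}$). Local Goldilocks point: $p\in\partial\Omega$ is a local Goldilocks point of $\Omega$ (equivalently, $\Omega$ is locally Goldilocks at $p$) if there is a neighbourhood $U$ of $p$ such that (1) for some $\epsilon>0$, $\int_0^\epsilon \frac1r M_{\Omega,U}(r)\,dr<\infty$, where $M_{\Omega,U}(r):=\sup\{1/\kappa_\Omega(z;v): z\in U\cap\Omega,\ \delta_\Omega(z)\le r,\ |v|=1\}$; and (2) for each $z_0\in\Omega$ there exist constants $C,\alpha>0$ such that $\mathsf{k}_\Omega(z_0,z)\le C+\alpha\log(1/\delta_\Omega(z))$ for all $z\in U\cap\Omega$. Almost-geodesics: for $\lambda\ge1,\kappa\ge0$ and an interval $I\subset\mathbb{R}$, a map $\sigma:I\to\Omega$ is a $(\lambda,\kappa)$-almost-geodesic if (i) $\frac1\lambda|s-t|-\kappa\le \mathsf{k}_\Omega(\sigma(s),\sigma(t))\le\lambda|s-t|+\kappa$ for all $s,t\in I$; (ii) $\sigma$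 is absolutely continuous and $\kappa_\Omega(\sigma(t);\sigma'(t))\le\lambda$ for a.e. $t\in I$. End compactification: if $\Omega$ is bounded, $\overline{\Omega}^{End}:=\overline{\Omega}$. If $\Omega$ is unbounded, fix an exhaustion $(K_j)_{j\ge1}$ of $\overline\Omega$ by compact sets with $K_j$ contained in the interior (in $\overline\Omega$) of $K_{j+1}$. An end of $\overline\Omega$ is a sequence $(F_j)_{j\ge1}$ with $F_j$ a connected component of $\overline\Omega\setminus K_j$ and $F_{j+1}\subset F_j$. As a set, $\overline{\Omega}^{End}$ is $\overline\Omega$ together with all ends. Points of $\overline\Omega$ have their Euclidean neighbourhoods in $\overline\Omega$ as neighbourhood basis; an end $(F_j)_j$ has the neighbourhood basis $(\widehat F_j)_j$, where $\widehat F_j$ is $F_j$ together with all ends $(G_\nu)_\nu$ with $G_\nu=F_\nu$ for $\nu=1,\dots,j$. (Up to natural homeomorphism this does not depend on the exhaustion.) $\partial\overline{\Omega}^{End}:=\overline{\Omega}^{End}\setminus\Omega$. Visibility: distinct $\zeta,\eta\in\partial\overline{\Omega}^{End}$ satisfy the $(\lambda,\kappa)$-visibility property if there exist neighbourhoods $V_\zeta$, $V_\eta$ of $\zeta,\eta$ in $\overline{\Omega}^{End}$ with $\overline{V_\zeta}\cap\overline{V_\eta}=\emptyset$ and a compact $K\subset\Omega$ such that every $(\lambda,\kappa)$-almost-geodesic $\sigma:[0,T]\to\Omega$ with $\sigma(0)\in V_\zeta$, $\sigma(T)\in V_\eta$ satisfies $\sigma([0,T])\cap K\ne\emptyset$.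 A hyperbolic domain $\Omega$ is a visibility domain if for all $\lambda\ge1$ and $\kappa>0$ every pair of distinct points of $\partial\overline{\Omega}^{End}$ satisfies the $(\lambda,\kappa)$-visibility property. *)

theory Defs
  imports "HOL-Analysis.Analysis"
begin

section \<open>Kobayashi distance and Kobayashi--Royden metric\<close>

definition planar_domain :: "complex set \<Rightarrow> bool" where
  "planar_domain \<Omega> \<longleftrightarrow> open \<Omega> \<and> connected \<Omega> \<and> \<Omega> \<noteq> {}"

definition holo_disc :: "complex set \<Rightarrow> (complex \<Rightarrow> complex) \<Rightarrow> bool" where
  "holo_disc \<Omega> f \<longleftrightarrow> f holomorphic_on ball 0 1 \<and> f ` ball 0 1 \<subseteq> \<Omega>"

text \<open>Normalisation: curvature \<open>-4\<close>, so that the infinitesimal metric of the unit disc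
  at the origin is \<open>norm v\<close>, in agreement with \<open>kobayashi_metric\<close> below.\<close>

definition poincare_dist :: "complex \<Rightarrow> complex \<Rightarrow> real" where
  "poincare_dist a b = artanh (norm ((a - b) / (1 - cnj b * a)))"

text \<open>Infimum over chains of holomorphic discs
  \<open>f 0, \<dots>, f (m - 1)\<close> joining \<open>z = p 0, p 1, \<dots>, p m = w\<close>.\<close>

definition kobayashi_dist :: "complex set \<Rightarrow> complex \<Rightarrow> complex \<Rightarrow> real" where
  "kobayashi_dist \<Omega> z w =
     Inf {(\<Sum>i<m. poincare_dist (a i) (b i)) | (m :: nat) p f a b.
            p 0 = z \<and> p m = w \<and>
            (\<forall>i<m. holo_disc \<Omega> (f i) \<and> a i \<in> ball 0 1 \<and> b i \<in> ball 0 1 \<and>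
                   f i (a i) = p i \<and> f i (b i) = p (Suc i))}"

definition kobayashi_metric :: "complex set \<Rightarrow> complex \<Rightarrow> complex \<Rightarrow> real" where
  "kobayashi_metric \<Omega> z v =
     Inf {norm \<xi> | \<xi> f. holo_disc \<Omega> f \<and> f 0 = z \<and> deriv f 0 * \<xi> = v}"

text \<open>On a domain \<open>kobayashi_dist\<close> is always a finite pseudodistance, so that being a distance
  amounts to separating points.\<close>

definition hyperbolic_domain :: "complex set \<Rightarrow> bool" where
  "hyperbolic_domain \<Omega> \<longleftrightarrow>
     planar_domain \<Omega> \<and> (\<forall>z\<in>\<Omega>. \<forall>w\<in>\<Omega>. kobayashi_dist \<Omega> z w = 0 \<longrightarrow> z = w)"

section \<open>Local Goldilocks points\<close>

abbreviation bdry_dist :: "complex set \<Rightarrow> complex \<Rightarrow> real" where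
  "bdry_dist \<Omega> z \<equiv> infdist z (frontier \<Omega>)"

text \<open>Taken in \<^typ>\<open>ennreal\<close>: the supremum may be infinite, \<open>1 / 0\<close> is infinite, and the
  supremum of the empty set is \<open>0\<close>.\<close>

definition goldilocks_M :: "complex set \<Rightarrow> complex set \<Rightarrow> real \<Rightarrow> ennreal" where
  "goldilocks_M \<Omega> U r =
     Sup {1 / ennreal (kobayashi_metric \<Omega> z v) | z v.
            z \<in> U \<inter> \<Omega> \<and> bdry_dist \<Omega> z \<le> r \<and> norm v = 1}"

definition local_goldilocks_point :: "complex set \<Rightarrow> complex \<Rightarrow> bool" where
  "local_goldilocks_point \<Omega> p \<longleftrightarrow>
     p \<in> frontier \<Omega> \<and>
     (\<exists>U. open U \<and> p \<in> U \<and>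
        (\<exists>\<epsilon>>0. (\<integral>\<^sup>+ r\<in>{0<..<\<epsilon>}. (1 / ennreal r) * goldilocks_M \<Omega> U r \<partial>lborel) < \<infinity>) \<and>
        (\<forall>z0\<in>\<Omega>. \<exists>C>0. \<exists>\<alpha>>0. \<forall>z \<in> U \<inter> \<Omega>.
           kobayashi_dist \<Omega> z0 z \<le> C + \<alpha> * ln (1 / bdry_dist \<Omega> z)))"

section \<open>Almost-geodesics\<close>

text \<open>The family \<open>\<D>\<close> ranges over the finite families of non-overlapping compact
  subintervals \<open>J = {Inf J..Sup J}\<close> of \<open>I\<close>.\<close>

definition abs_continuous_on :: "real set \<Rightarrow> (real \<Rightarrow> complex) \<Rightarrow> bool" where
  "abs_continuous_on I \<sigma> \<longleftrightarrow>
     (\<forall>\<epsilon>>0. \<exists>\<delta>>0. \<forall>\<D>. \<D> division_of \<Union>\<D> \<and> \<Union>\<D> \<subseteq> I \<and> (\<Sum>J\<in>\<D>. Sup J - Inf J) < \<delta>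
        \<longrightarrow> (\<Sum>J\<in>\<D>. norm (\<sigma> (Sup J) - \<sigma> (Inf J))) < \<epsilon>)"

definition almost_geodesic ::
  "complex set \<Rightarrow> real \<Rightarrow> real \<Rightarrow> real set \<Rightarrow> (real \<Rightarrow> complex) \<Rightarrow> bool" where
  "almost_geodesic \<Omega> lam kap I \<sigma> \<longleftrightarrow>
     \<sigma> \<in> I \<rightarrow> \<Omega> \<and>
     (\<forall>s\<in>I. \<forall>t\<in>I. 1 / lam * \<bar>s - t\<bar> - kap \<le> kobayashi_dist \<Omega> (\<sigma> s) (\<sigma> t) \<and>
                   kobayashi_dist \<Omega> (\<sigma> s) (\<sigma> t) \<le> lam * \<bar>s - t\<bar> + kap) \<and>
     abs_continuous_on I \<sigma> \<and>
     (AE t in lborel. t \<in> I \<longrightarrow>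
        (\<exists>v. (\<sigma> has_vector_derivative v) (at t within I) \<and> kobayashi_metric \<Omega> (\<sigma> t) v \<le> lam))"

section \<open>End compactification\<close>

definition exhaustion :: "complex set \<Rightarrow> (nat \<Rightarrow> complex set) \<Rightarrow> bool" where
  "exhaustion X K \<longleftrightarrow>
     (\<forall>j. compact (K j)) \<and> (\<Union>j. K j) = X \<and>
     (\<forall>j. K j \<subseteq> top_of_set X interior_of K (Suc j))"

lemma exhaustion_cball:
  assumes "closed X"
  shows "exhaustion X (\<lambda>j. X \<inter> cball 0 (real j))"
proof -
  have "X \<inter> cball 0 (real j) \<subseteq> top_of_set X interior_of (X \<inter> cball 0 (real (Suc j)))" for j
  proof -
    have "X \<inter> ball 0 (real (Suc j)) \<subseteq> top_of_set X interior_of (X \<inter> cball 0 (real (Suc j)))"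
      by (rule interior_of_maximal) (auto simp: openin_open)
    moreover have "X \<inter> cball 0 (real j) \<subseteq> X \<inter> ball 0 (real (Suc j))"
      by auto
    ultimately show ?thesis
      by blast
  qed
  moreover have "(\<Union>j. X \<inter> cball 0 (real j)) = X"
    by (auto simp: real_arch_simple)
  ultimately show ?thesis
    using assms by (simp add: exhaustion_def closed_Int_compact)
qed

definition ends :: "complex set \<Rightarrow> (nat \<Rightarrow> complex set) \<Rightarrow> (nat \<Rightarrow> complex set) set" where
  "ends \<Omega> K =
     (if bounded \<Omega> then {}
      else {F. \<forall>j. F j \<in> components (closure \<Omega> - K j) \<and> F (Suc j) \<subseteq> F j})"

datatype end_point = Pt complex | End "nat \<Rightarrow> complex set"

definition end_nbhd ::
  "complex set \<Rightarrow> (nat \<Rightarrow> complex set) \<Rightarrow> (nat \<Rightarrow> complex set) \<Rightarrow> nat \<Rightarrow> end_point set" where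
  "end_nbhd \<Omega> K F j = Pt ` F j \<union> End ` {G \<in> ends \<Omega> K. \<forall>i\<le>j. G i = F i}"

text \<open>The topology determined by the basic neighbourhoods: a set is open iff it contains a basic
  neighbourhood of each of its points.\<close>

definition end_compactification ::
  "complex set \<Rightarrow> (nat \<Rightarrow> complex set) \<Rightarrow> end_point topology" where
  "end_compactification \<Omega> K = topology (\<lambda>U.
     U \<subseteq> Pt ` closure \<Omega> \<union> End ` ends \<Omega> K \<and>
     (\<forall>z. Pt z \<in> U \<longrightarrow> (\<exists>e>0. Pt ` (ball z e \<inter> closure \<Omega>) \<subseteq> U)) \<and>
     (\<forall>F. End F \<in> U \<longrightarrow> (\<exists>j. end_nbhd \<Omega> K F j \<subseteq> U)))"

lemma end_nbhd_antimono:
  assumes "F \<in> ends \<Omega> K" "i \<le> j"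
  shows "end_nbhd \<Omega> K F j \<subseteq> end_nbhd \<Omega> K F i"
proof -
  have "F (Suc n) \<subseteq> F n" for n
    using assms(1) by (auto simp: ends_def split: if_splits)
  then have "F j \<subseteq> F i"
    using assms(2) by (rule lift_Suc_antimono_le)
  then show ?thesis
    using assms(2) by (auto simp: end_nbhd_def)
qed

lemma openin_end_compactification:
  "openin (end_compactification \<Omega> K) U \<longleftrightarrow>
     U \<subseteq> Pt ` closure \<Omega> \<union> End ` ends \<Omega> K \<and>
     (\<forall>z. Pt z \<in> U \<longrightarrow> (\<exists>e>0. Pt ` (ball z e \<inter> closure \<Omega>) \<subseteq> U)) \<and>
     (\<forall>F. End F \<in> U \<longrightarrow> (\<exists>j. end_nbhd \<Omega> K F j \<subseteq> U))"
proof -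
  let ?P = "\<lambda>U. U \<subseteq> Pt ` closure \<Omega> \<union> End ` ends \<Omega> K \<and>
     (\<forall>z. Pt z \<in> U \<longrightarrow> (\<exists>e>0. Pt ` (ball z e \<inter> closure \<Omega>) \<subseteq> U)) \<and>
     (\<forall>F. End F \<in> U \<longrightarrow> (\<exists>j. end_nbhd \<Omega> K F j \<subseteq> U))"
  have "?P (S \<inter> T)" if S: "?P S" and T: "?P T" for S T
  proof (intro conjI allI impI)
    show "S \<inter> T \<subseteq> Pt ` closure \<Omega> \<union> End ` ends \<Omega> K"
      using S by blast
  next
    fix z assume z: "Pt z \<in> S \<inter> T"
    obtain d where d: "d > 0" "Pt ` (ball z d \<inter> closure \<Omega>) \<subseteq> S"
      using S z by blast
    obtain e where e: "e > 0" "Pt ` (ball z e \<inter> closure \<Omega>) \<subseteq> T"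
      using T z by blast
    have "Pt ` (ball z (min d e) \<inter> closure \<Omega>) \<subseteq> S \<inter> T"
      using d(2) e(2) by auto
    then show "\<exists>e>0. Pt ` (ball z e \<inter> closure \<Omega>) \<subseteq> S \<inter> T"
      using d(1) e(1) by (intro exI[of _ "min d e"]) auto
  next
    fix F assume F: "End F \<in> S \<inter> T"
    then have FE: "F \<in> ends \<Omega> K"
      using S by auto
    obtain i where i: "end_nbhd \<Omega> K F i \<subseteq> S"
      using S F by blast
    obtain j where j: "end_nbhd \<Omega> K F j \<subseteq> T"
      using T F by blast
    have "end_nbhd \<Omega> K F (max i j) \<subseteq> S \<inter> T"
      using i j end_nbhd_antimono[OF FE, of i "max i j"] end_nbhd_antimono[OF FE, of j "max i j"]
      by auto
    then show "\<exists>j. end_nbhd \<Omega> K F j \<subseteq> S \<inter> T"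
      by blast
  qed
  moreover have "?P (\<Union>\<K>)" if "\<forall>S\<in>\<K>. ?P S" for \<K>
  proof (intro conjI allI impI)
    show "\<Union>\<K> \<subseteq> Pt ` closure \<Omega> \<union> End ` ends \<Omega> K"
      using that by (meson Sup_least)
  next
    fix z assume "Pt z \<in> \<Union>\<K>"
    then obtain S where "S \<in> \<K>" "Pt z \<in> S" by blast
    then show "\<exists>e>0. Pt ` (ball z e \<inter> closure \<Omega>) \<subseteq> \<Union>\<K>"
      using that by (meson Union_upper order_trans)
  next
    fix F assume "End F \<in> \<Union>\<K>"
    then obtain S where "S \<in> \<K>" "End F \<in> S" by blast
    then show "\<exists>j. end_nbhd \<Omega> K F j \<subseteq> \<Union>\<K>"
      using that by (meson Union_upper order_trans)
  qed
  ultimately have "istopology ?P"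
    unfolding istopology_def by blast
  then show ?thesis
    unfolding end_compactification_def by (simp only: topology_inverse')
qed

lemma topspace_end_compactification:
  "topspace (end_compactification \<Omega> K) = Pt ` closure \<Omega> \<union> End ` ends \<Omega> K"
proof -
  have "F j \<subseteq> closure \<Omega>" if "F \<in> ends \<Omega> K" for F j
    using that in_components_subset by (fastforce simp: ends_def split: if_splits)
  then have "openin (end_compactification \<Omega> K) (Pt ` closure \<Omega> \<union> End ` ends \<Omega> K)"
    unfolding openin_end_compactification end_nbhd_def by (force intro: exI[of _ "1::real"])
  then show ?thesis
    by (metis openin_end_compactification openin_subset openin_topspace subset_antisym)
qed

definition end_boundary :: "complex set \<Rightarrow> (nat \<Rightarrow> complex set) \<Rightarrow> end_point set" where
  "end_boundary \<Omega> K = topspace (end_compactification \<Omega> K) - Pt ` \<Omega>"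

section \<open>Visibility\<close>

definition visible_pair ::
  "complex set \<Rightarrow> (nat \<Rightarrow> complex set) \<Rightarrow> real \<Rightarrow> real \<Rightarrow> end_point \<Rightarrow> end_point \<Rightarrow> bool" where
  "visible_pair \<Omega> K lam kap \<zeta> \<eta> \<longleftrightarrow>
     (\<exists>V W L. openin (end_compactification \<Omega> K) V \<and> \<zeta> \<in> V \<and>
        openin (end_compactification \<Omega> K) W \<and> \<eta> \<in> W \<and>
        (end_compactification \<Omega> K closure_of V) \<inter> (end_compactification \<Omega> K closure_of W) = {} \<and>
        compact L \<and> L \<subseteq> \<Omega> \<and>
        (\<forall>T\<ge>0. \<forall>\<sigma>. almost_geodesic \<Omega> lam kap {0..T} \<sigma> \<and> Pt (\<sigma> 0) \<in> V \<and> Pt (\<sigma> T) \<in> W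
           \<longrightarrow> \<sigma> ` {0..T} \<inter> L \<noteq> {}))"

text \<open>The end compactification does not depend on the exhaustion, up to natural homeomorphism;
  no exhaustion is singled out here.\<close>

definition visibility_domain :: "complex set \<Rightarrow> bool" where
  "visibility_domain \<Omega> \<longleftrightarrow>
     hyperbolic_domain \<Omega> \<and>
     (\<forall>K. exhaustion (closure \<Omega>) K \<longrightarrow>
        (\<forall>lam\<ge>1. \<forall>kap>0. \<forall>\<zeta>\<in>end_boundary \<Omega> K. \<forall>\<eta>\<in>end_boundary \<Omega> K.
           \<zeta> \<noteq> \<eta> \<longrightarrow> visible_pair \<Omega> K lam kap \<zeta> \<eta>))"

end

theory Submission
  imports Defs "HOL-Complex_Analysis.Complex_Analysis" "HOL-Real_Asymp.Real_Asymp"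
begin

text \<open>
  If the complement of a planar domain is totally disconnected and the domain has a single end, then
  visibility is a purely topological matter: small boxes whose boundary curves lie in
  the domain separate the points of the end boundary, and every path between two of them crosses
  such a curve. The domain here is the complement of \<open>C \<times> C\<close>, where the Cantor-like set \<open>C\<close> is
  obtained by removing, for every \<open>n\<close>, the open intervals of radius \<open>s (n + 1)\<close> around the
  multiples of \<open>s n = 2 powr (- (n + 1)\<^sup>2)\<close>. Inside a surviving square of side \<open>s n\<close> the dust is
  \<open>s (n + 1)\<close>-dense, so by Schottky's theorem the Kobayashi metric there is at least of order
  \<open>1 / s (n + 1)\<close>, and the centre of the square has Kobayashi distance at least of order
  \<open>s n / s (n + 1) = 2 ^ (2 n + 3)\<close> from \<open>0\<close>. Its distance to the boundary is at least \<open>s (n + 2)\<close>,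
  whose logarithm is only quadratic in \<open>n\<close>. Such squares shrink to every boundary point, so the
  logarithmic growth condition of local Goldilocks points always fails.
\<close>

section \<open>Lower bounds for the Kobayashi distance\<close>

text \<open>Schottky's bound at \<open>norm z = 1/2\<close>, for functions on the closed unit disc
  omitting 0 and 1 whose value at 0 has norm at most \<open>r\<close>: there the term
  \<open>12 * t / (1 - t)\<close> equals 12.\<close>

definition schottky_bound :: "real \<Rightarrow> real" where
  "schottky_bound r = exp (pi * exp (pi * (2 + 2 * r + 12)))"

lemma schottky_bound_pos: "schottky_bound r > 0"
  by (simp add: schottky_bound_def)

text \<open>An affine change in the target moves \<open>a\<close>, \<open>b\<close> to 0, 1.
  Schottky then bounds the function on the disc of radius 1/2, and Cauchy's inequality bounds its
  derivative at the centre. Of the factor 4, one 2 comes from Cauchy's radius and one from the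
  rescaling of the source.\<close>

lemma norm_deriv_le_of_omitted_pair:
  assumes holo: "f holomorphic_on ball \<zeta> \<rho>" and \<rho>: "\<rho> > 0" and ne: "a \<noteq> b"
    and omits: "\<And>w. w \<in> ball \<zeta> \<rho> \<Longrightarrow> f w \<noteq> a \<and> f w \<noteq> b"
    and near: "norm (f \<zeta> - a) \<le> r * norm (b - a)"
  shows "norm (deriv f \<zeta>) \<le> 4 * schottky_bound r * norm (b - a) / \<rho>"
proof -
  \<comment> \<open>The factor \<open>\<rho> / 2\<close> instead of \<open>\<rho>\<close> makes
    \<open>h\<close> holomorphic on a disc larger than the closed unit disc, on which Schottky's
    theorem is applied.\<close>
  define h where "h = (\<lambda>w. (f (\<zeta> + of_real (\<rho> / 2) * w) - a) / (b - a))"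
  have inball: "\<zeta> + of_real (\<rho> / 2) * w \<in> ball \<zeta> \<rho>" if "w \<in> ball 0 2" for w
    using that \<rho> by (simp add: dist_norm norm_mult)
  have h_holo2: "h holomorphic_on ball 0 2"
    unfolding h_def
    using ne inball
    by (intro holomorphic_intros holomorphic_on_compose_gen[OF _ holo, unfolded o_def]) auto
  have h_holo: "h holomorphic_on cball 0 1"
    using h_holo2 by (rule holomorphic_on_subset) auto
  have "norm (h 0) \<le> r"
    using near ne by (simp add: h_def norm_divide divide_simps)
  moreover have "\<not> (h w = 0 \<or> h w = 1)" if "w \<in> cball 0 1" for w
    using omits[OF inball[of w]] that ne by (auto simp: h_def)
  ultimately have h_bound: "norm (h w) \<le> schottky_bound r" if "norm w \<le> 1/2" for w
    using Schottky[OF h_holo, of r "1/2" w] that by (simp add: schottky_bound_def)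
  have "norm ((deriv ^^ 1) h 0) \<le> fact 1 * schottky_bound r / (1/2) ^ 1"
  proof (rule Cauchy_inequality)
    show "h holomorphic_on ball 0 (1/2)"
      using h_holo2 by (rule holomorphic_on_subset) auto
    show "continuous_on (cball 0 (1/2)) h"
      using h_holo2 by (intro holomorphic_on_imp_continuous_on, rule holomorphic_on_subset) auto
  qed (use h_bound in auto)
  then have "norm (deriv h 0) \<le> 2 * schottky_bound r"
    by simp
  moreover have "(h has_field_derivative deriv f \<zeta> * of_real (\<rho> / 2) / (b - a)) (at 0)"
  proof -
    have "(f has_field_derivative deriv f \<zeta>) (at \<zeta>)"
      using holo \<rho> by (simp add: holomorphic_derivI)
    then have "(f has_field_derivative deriv f \<zeta>) (at (\<zeta> + of_real (\<rho> / 2) * 0))"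
      by simp
    moreover have "((\<lambda>w. \<zeta> + of_real (\<rho> / 2) * w) has_field_derivative of_real (\<rho> / 2)) (at 0)"
      by (auto intro!: derivative_eq_intros)
    ultimately have "((\<lambda>w. f (\<zeta> + of_real (\<rho> / 2) * w)) has_field_derivative
        deriv f \<zeta> * of_real (\<rho> / 2)) (at 0)"
      by (rule DERIV_chain2)
    then show ?thesis
      unfolding h_def using ne by (auto intro!: derivative_eq_intros)
  qed
  then have "deriv h 0 = deriv f \<zeta> * of_real (\<rho> / 2) / (b - a)"
    by (rule DERIV_imp_deriv)
  ultimately have "norm (deriv f \<zeta>) * \<rho> / 2 / norm (b - a) \<le> 2 * schottky_bound r"
    using \<rho> by (simp only: norm_mult norm_divide norm_of_real)
  then show ?thesis
    using \<rho> ne by (simp add: pos_divide_le_eq pos_le_divide_eq mult_ac)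
qed

text \<open>\<open>- ln (1 - t)\<close> is the integral of \<open>1 / (1 - s)\<close> over
  \<open>[0, t]\<close>, the quantity that the derivative bound below produces along a radius;
  \<open>artanh\<close> is the Poincare distance from 0.\<close>

lemma ln_le_artanh:
  assumes "0 \<le> (t::real)" "t < 1"
  shows "- ln (1 - t) \<le> 2 * artanh t"
proof -
  have "2 * artanh t = ln (1 + t) - ln (1 - t)"
    using assms by (simp add: artanh_def ln_divide_pos)
  then show ?thesis
    using assms by simp
qed

text \<open>Only the part of the radius before \<open>g\<close> first leaves \<open>ball w R\<close> matters: from there on the
  cone \<open>max 0 (R - dist _ w)\<close> has nothing left to lose.\<close>

lemma cone_decrease_le:
  fixes g :: "complex \<Rightarrow> complex"
  assumes holo: "g holomorphic_on ball 0 1" and c: "norm c < 1" and M: "M \<ge> 0"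
    and deriv: "\<And>\<zeta>. \<lbrakk>norm \<zeta> < 1; dist (g \<zeta>) w < R\<rbrakk> \<Longrightarrow> norm (deriv g \<zeta>) \<le> M / (1 - norm \<zeta>)"
  shows "max 0 (R - dist (g 0) w) - max 0 (R - dist (g c) w) \<le> 2 * M * artanh (norm c)"
proof -
  define T where "T = norm c"
  obtain e where e: "norm e = 1" "c = of_real T * e"
  proof (cases "c = 0")
    case True
    then show ?thesis using that[of 1] by (simp add: T_def)
  next
    case False
    then show ?thesis using that[of "c / of_real T"] by (simp add: T_def norm_divide)
  qed
  define \<gamma> where "\<gamma> = (\<lambda>t. g (of_real t * e))"
  have T: "0 \<le> T" "T < 1"
    using c by (auto simp: T_def)
  have cont: "continuous_on {0..t} \<gamma>" if "t \<le> T" for t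
    unfolding \<gamma>_def using that T e
    by (intro continuous_on_compose2[OF holomorphic_on_imp_continuous_on[OF holo]] continuous_intros)
      (auto simp: norm_mult)
  have mono: "- ln (1 - t) \<le> 2 * artanh T" if "0 \<le> t" "t \<le> T" for t
    using ln_le_artanh[OF T] that T by (smt (verit) ln_le_cancel_iff)
  have run: "dist (\<gamma> 0) (\<gamma> t) \<le> 2 * M * artanh T"
    if t: "0 \<le> t" "t \<le> T" and inside: "\<And>s. \<lbrakk>0 < s; s < t\<rbrakk> \<Longrightarrow> dist (\<gamma> s) w < R" for t
  proof (cases "t = 0")
    case True
    then show ?thesis using mono[of 0] T M by simp
  next
    case False
    \<comment> \<open>The majorant \<open>- M * ln (1 - s)\<close> has derivative
      \<open>M / (1 - s)\<close>, which is exactly the assumed bound on the speed of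
      \<open>\<gamma>\<close>.\<close>
    have "norm (\<gamma> t - \<gamma> 0) \<le> - M * ln (1 - t) - - M * ln (1 - 0)"
    proof (rule differentiable_bound_general)
      show "0 < t" using False t by simp
      show "continuous_on {0..t} \<gamma>" using cont t by simp
      show "continuous_on {0..t} (\<lambda>s. - M * ln (1 - s))"
        using t T by (intro continuous_intros) auto
      fix s assume s: "0 < s" "s < t"
      have norm_s: "norm (of_real s * e) = s"
        using s e by (simp add: norm_mult)
      have "(g has_field_derivative deriv g (of_real s * e)) (at (of_real s * e))"
        using s t T by (intro holomorphic_derivI[OF holo]) (auto simp: norm_s)
      moreover have "((\<lambda>s. of_real s * e) has_vector_derivative e) (at s)"
        by (auto intro!: derivative_eq_intros)
      ultimately show "(\<gamma> has_vector_derivative e * deriv g (of_real s * e)) (at s)"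
        unfolding \<gamma>_def using field_vector_diff_chain_at[of "\<lambda>s. of_real s * e" e s g]
        by (simp add: o_def)
      show "((\<lambda>s. - M * ln (1 - s)) has_vector_derivative M / (1 - s)) (at s)"
        using s t T unfolding has_real_derivative_iff_has_vector_derivative[symmetric]
        by (auto intro!: derivative_eq_intros simp: field_simps)
      show "norm (e * deriv g (of_real s * e)) \<le> M / (1 - s)"
        using deriv[of "of_real s * e"] inside[OF s] s t T e
        by (simp add: norm_mult norm_s \<gamma>_def)
    qed
    also have "\<dots> = M * (- ln (1 - t))" by simp
    also have "\<dots> \<le> M * (2 * artanh T)"
      using mono[OF t] M by (rule mult_left_mono)
    finally show ?thesis by (simp add: dist_norm norm_minus_commute mult_ac)
  qed
  have nonneg: "0 \<le> 2 * M * artanh T"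
    using run[of 0] T by (smt (verit) zero_le_dist)
  have g0: "\<gamma> 0 = g 0" and gT: "\<gamma> T = g c"
    by (simp_all add: \<gamma>_def e)
  have "max 0 (R - dist (\<gamma> 0) w) - max 0 (R - dist (\<gamma> T) w) \<le> 2 * M * artanh T"
  proof (cases "\<exists>t\<in>{0..T}. R \<le> dist (\<gamma> t) w")
    case False
    then have "dist (\<gamma> 0) (\<gamma> T) \<le> 2 * M * artanh T"
      using T by (intro run) (auto simp: not_le)
    moreover have "dist (\<gamma> T) w \<le> dist (\<gamma> 0) (\<gamma> T) + dist (\<gamma> 0) w"
      by (metis dist_commute dist_triangle)
    ultimately show ?thesis
      using nonneg by linarith
  next
    case True
    \<comment> \<open>The least element of \<open>S\<close> is the first exit time. The path up to
      it has length controlled by \<open>run\<close> and already reaches distance \<open>R\<close>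
      from \<open>w\<close>.\<close>
    define S where "S = {t \<in> {0..T}. R \<le> dist (\<gamma> t) w}"
    have "compact S"
      unfolding compact_eq_bounded_closed
    proof
      show "bounded S" by (rule bounded_subset[of "{0..T}"]) (auto simp: S_def)
      show "closed S"
        unfolding S_def using cont[of T]
        by (intro continuous_closed_preimage_constant continuous_on_closed_Collect_le) (auto intro!: continuous_intros)
    qed
    moreover have "S \<noteq> {}" using True by (auto simp: S_def)
    ultimately obtain t where t: "t \<in> S" "\<And>s. s \<in> S \<Longrightarrow> t \<le> s"
      using compact_attains_inf by meson
    have "dist (\<gamma> s) w < R" if "0 < s" "s < t" for s
    proof -
      have "s \<notin> S" using t(2)[of s] that by linarith
      moreover have "s \<in> {0..T}" using t(1) that by (simp add: S_def)
      ultimately show ?thesis by (simp add: S_def)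
    qed
    then have "dist (\<gamma> 0) (\<gamma> t) \<le> 2 * M * artanh T"
      using t(1) by (intro run) (auto simp: S_def)
    moreover have "R \<le> dist (\<gamma> t) w" using t by (simp add: S_def)
    moreover have "dist (\<gamma> t) w \<le> dist (\<gamma> 0) (\<gamma> t) + dist (\<gamma> 0) w"
      by (metis dist_commute dist_triangle)
    ultimately show ?thesis
      using nonneg by linarith
  qed
  then show ?thesis by (simp only: g0 gT T_def[symmetric])
qed

section \<open>From radii to arbitrary pairs of points in a disc\<close>

lemma poincare_dist_commute: "poincare_dist a b = poincare_dist b a"
proof -
  have "norm (1 - cnj a * b) = norm (cnj (1 - cnj a * b))"
    by (simp only: complex_mod_cnj)
  also have "cnj (1 - cnj a * b) = 1 - cnj b * a" by (simp add: mult.commute)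
  finally show ?thesis
    by (simp add: poincare_dist_def norm_divide norm_minus_commute)
qed

lemma cone_decrease_le_poincare_dist:
  assumes disc: "holo_disc \<Omega> f" and ab: "a \<in> ball 0 1" "b \<in> ball 0 1"
    and omitted: "\<And>\<zeta>. \<lbrakk>\<zeta> \<in> \<Omega>; dist \<zeta> w < R\<rbrakk> \<Longrightarrow>
      \<exists>p q. p \<notin> \<Omega> \<and> q \<notin> \<Omega> \<and> p \<noteq> q \<and> norm (q - p) \<le> s \<and> norm (\<zeta> - p) \<le> r * norm (q - p)"
    and s: "s \<ge> 0"
  shows "max 0 (R - dist (f a) w) - max 0 (R - dist (f b) w)
    \<le> 8 * schottky_bound r * s * poincare_dist a b"
proof -
  \<comment> \<open>The automorphism sends 0 to \<open>a\<close> and \<open>c\<close> to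
    \<open>b\<close>, which reduces the pair to the endpoints of a radius.\<close>
  define g where "g = f \<circ> Moebius_function 0 (- a)"
  define c where "c = Moebius_function 0 a b"
  have na: "norm a < 1" "norm b < 1" using ab by auto
  have g_holo: "g holomorphic_on ball 0 1"
    unfolding g_def
    using disc na Moebius_function_norm_lt_1[of "-a" _ 0]
    by (intro holomorphic_on_compose_gen[OF Moebius_function_holomorphic, of "-a" f "ball 0 1"])
      (auto simp: holo_disc_def)
  have g_in: "g \<zeta> \<in> \<Omega>" if "norm \<zeta> < 1" for \<zeta>
    using disc that na Moebius_function_norm_lt_1[of "-a" \<zeta> 0] by (auto simp: g_def holo_disc_def)
  have c: "norm c < 1"
    unfolding c_def using na by (intro Moebius_function_norm_lt_1)
  have pd: "poincare_dist a b = artanh (norm c)"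
    by (subst poincare_dist_commute) (simp add: poincare_dist_def c_def Moebius_function_simple)
  have g0: "g 0 = f a" by (simp add: g_def Moebius_function_simple)
  have gc: "g c = f b"
    unfolding g_def c_def o_def using na by (subst Moebius_function_compose) auto
  have "max 0 (R - dist (g 0) w) - max 0 (R - dist (g c) w)
      \<le> 2 * (4 * schottky_bound r * s) * artanh (norm c)"
  proof (rule cone_decrease_le[OF g_holo c])
    show "0 \<le> 4 * schottky_bound r * s"
      using s schottky_bound_pos[of r] by simp
    fix \<zeta> :: complex assume \<zeta>: "norm \<zeta> < 1" "dist (g \<zeta>) w < R"
    obtain p q where pq: "p \<notin> \<Omega>" "q \<notin> \<Omega>" "p \<noteq> q" "norm (q - p) \<le> s"
      "norm (g \<zeta> - p) \<le> r * norm (q - p)"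
      using omitted[OF g_in \<zeta>(2)] \<zeta>(1) by blast
    \<comment> \<open>On this ball \<open>g\<close> omits \<open>p\<close> and \<open>q\<close>, so
      the derivative estimate applies with \<open>\<rho> = 1 - norm \<zeta>\<close>.\<close>
    have sub: "ball \<zeta> (1 - norm \<zeta>) \<subseteq> ball 0 1"
      by (simp add: ball_subset_ball_iff dist_norm)
    have "norm (deriv g \<zeta>) \<le> 4 * schottky_bound r * norm (q - p) / (1 - norm \<zeta>)"
    proof (rule norm_deriv_le_of_omitted_pair)
      show "g holomorphic_on ball \<zeta> (1 - norm \<zeta>)"
        using g_holo sub by (rule holomorphic_on_subset)
      show "g v \<noteq> p \<and> g v \<noteq> q" if "v \<in> ball \<zeta> (1 - norm \<zeta>)" for v
        using g_in[of v] that sub pq by auto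
    qed (use pq \<zeta> in auto)
    also have "\<dots> \<le> 4 * schottky_bound r * s / (1 - norm \<zeta>)"
      using pq \<zeta> schottky_bound_pos[of r] by (intro divide_right_mono mult_left_mono) auto
    finally show "norm (deriv g \<zeta>) \<le> 4 * schottky_bound r * s / (1 - norm \<zeta>)" .
  qed
  then show ?thesis by (simp add: g0 gc pd)
qed

section \<open>Chains of discs\<close>

definition disc_chain :: "complex set \<Rightarrow> complex \<Rightarrow> complex \<Rightarrow> nat \<Rightarrow> (nat \<Rightarrow> complex) \<Rightarrow>
    (nat \<Rightarrow> complex \<Rightarrow> complex) \<Rightarrow> (nat \<Rightarrow> complex) \<Rightarrow> (nat \<Rightarrow> complex) \<Rightarrow> bool" where
  "disc_chain \<Omega> z w m p f a b \<longleftrightarrow> p 0 = z \<and> p m = w \<and>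
     (\<forall>i<m. holo_disc \<Omega> (f i) \<and> a i \<in> ball 0 1 \<and> b i \<in> ball 0 1 \<and>
            f i (a i) = p i \<and> f i (b i) = p (Suc i))"

lemma kobayashi_dist_eq:
  "kobayashi_dist \<Omega> z w =
     Inf {(\<Sum>i<m. poincare_dist (a i) (b i)) | m p f a b. disc_chain \<Omega> z w m p f a b}"
  by (simp only: kobayashi_dist_def disc_chain_def)

text \<open>A lower bound for an infimum of reals requires a nonempty set. Nearby points are joined
  by one affine disc, so being joined by a chain is a locally constant equivalence relation, and
  connectedness makes it total.\<close>

lemma disc_chain_exists:
  assumes dom: "planar_domain \<Omega>" and zw: "z \<in> \<Omega>" "w \<in> \<Omega>"
  shows "\<exists>m p f a b. disc_chain \<Omega> z w m p f a b"
proof -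
  define link where "link = (\<lambda>z w. \<exists>f a b. holo_disc \<Omega> f \<and> a \<in> ball 0 1 \<and> b \<in> ball 0 1 \<and> f a = z \<and> f b = w)"
  have link_sym: "symp link"
    unfolding link_def symp_def by blast
  have "link\<^sup>*\<^sup>* z w"
  proof (rule connected_equivalence_relation[of \<Omega> z w "link\<^sup>*\<^sup>*"])
    show "connected \<Omega>" using dom by (simp add: planar_domain_def)
    show "link\<^sup>*\<^sup>* y x" if "link\<^sup>*\<^sup>* x y" for x y
      using that link_sym by (metis symp_rtranclp sympD)
    fix x assume x: "x \<in> \<Omega>"
    obtain e where e: "e > 0" "ball x e \<subseteq> \<Omega>"
      using dom x unfolding planar_domain_def open_contains_ball by blast
    have "link x y" if y: "y \<in> ball x e" for y
      unfolding link_def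
    proof (intro exI conjI)
      show "holo_disc \<Omega> (\<lambda>t. x + of_real e * t)"
        unfolding holo_disc_def using e
        by (auto intro!: holomorphic_intros subsetD[OF e(2)] simp: dist_norm norm_mult)
      show "0 \<in> ball (0::complex) 1" by simp
      show "(y - x) / of_real e \<in> ball 0 1"
        using y e by (simp add: dist_norm norm_divide norm_minus_commute)
    qed (use e in auto)
    then show "\<exists>T. openin (top_of_set \<Omega>) T \<and> x \<in> T \<and> (\<forall>y\<in>T. link\<^sup>*\<^sup>* x y)"
      using e by (intro exI[of _ "ball x e"]) (auto intro: open_subset)
  qed (use zw in auto)
  then obtain m where "(link ^^ m) z w" by (auto simp: rtranclp_power)
  then obtain p where p: "p 0 = z" "p m = w" "\<forall>i<m. link (p i) (p (Suc i))"
    unfolding relpowp_fun_conv by blast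
  have "\<exists>f a b. \<forall>i<m. holo_disc \<Omega> (f i) \<and> a i \<in> ball 0 1 \<and> b i \<in> ball 0 1 \<and>
                   f i (a i) = p i \<and> f i (b i) = p (Suc i)"
    using p(3) unfolding link_def by metis
  then show ?thesis using p(1,2) unfolding disc_chain_def by blast
qed

text \<open>The cone \<open>max 0 (R - dist _ w)\<close> is 0 at \<open>z\<close> and
  \<open>R\<close> at \<open>w\<close>. Along any chain it must rise by \<open>R\<close> in total,
  and each disc contributes at most a constant times its Poincare length.\<close>

lemma le_kobayashi_dist:
  assumes dom: "planar_domain \<Omega>" and zw: "z \<in> \<Omega>" "w \<in> \<Omega>" and R: "0 \<le> R" "R \<le> dist z w"
    and omitted: "\<And>\<zeta>. \<lbrakk>\<zeta> \<in> \<Omega>; dist \<zeta> w < R\<rbrakk> \<Longrightarrow>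
      \<exists>p q. p \<notin> \<Omega> \<and> q \<notin> \<Omega> \<and> p \<noteq> q \<and> norm (q - p) \<le> s \<and> norm (\<zeta> - p) \<le> r * norm (q - p)"
    and s: "s > 0"
  shows "R / (8 * schottky_bound r * s) \<le> kobayashi_dist \<Omega> z w"
  unfolding kobayashi_dist_eq
proof (rule cInf_greatest)
  let ?A = "8 * schottky_bound r * s"
  have A: "?A > 0" using s schottky_bound_pos[of r] by simp
  show "{(\<Sum>i<m. poincare_dist (a i) (b i)) | m p f a b. disc_chain \<Omega> z w m p f a b} \<noteq> {}"
    using disc_chain_exists[OF dom zw] by blast
  fix x assume "x \<in> {(\<Sum>i<m. poincare_dist (a i) (b i)) | m p f a b. disc_chain \<Omega> z w m p f a b}"
  then obtain m p f a b where x: "x = (\<Sum>i<m. poincare_dist (a i) (b i))"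
    and "disc_chain \<Omega> z w m p f a b"
    by blast
  then have p: "p 0 = z" "p m = w"
    and chain: "\<And>i. i < m \<Longrightarrow> holo_disc \<Omega> (f i) \<and> a i \<in> ball 0 1 \<and> b i \<in> ball 0 1 \<and>
                   f i (a i) = p i \<and> f i (b i) = p (Suc i)"
    by (simp_all add: disc_chain_def)
  define u where "u = (\<lambda>\<zeta>. max 0 (R - dist \<zeta> w))"
  have "R = u (p m) - u (p 0)"
    using p R by (simp add: u_def)
  also have "\<dots> = (\<Sum>i<m. u (p (Suc i)) - u (p i))"
    by (rule sum_lessThan_telescope[symmetric])
  also have "\<dots> \<le> (\<Sum>i<m. ?A * poincare_dist (a i) (b i))"
  proof (rule sum_mono)
    fix i assume "i \<in> {..<m}"
    then have i: "holo_disc \<Omega> (f i)" "a i \<in> ball 0 1" "b i \<in> ball 0 1"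
      "f i (a i) = p i" "f i (b i) = p (Suc i)"
      using chain by auto
    show "u (p (Suc i)) - u (p i) \<le> ?A * poincare_dist (a i) (b i)"
      \<comment> \<open>The points are swapped because a rise from \<open>a i\<close> to
        \<open>b i\<close> is a decrease from \<open>b i\<close> to \<open>a i\<close>.\<close>
      using cone_decrease_le_poincare_dist[of \<Omega> "f i" "b i" "a i" w R s r] omitted s i
      by (simp add: u_def poincare_dist_commute[of "a i"])
  qed
  also have "\<dots> = ?A * x"
    by (simp add: x sum_distrib_left)
  finally show "R / ?A \<le> x"
    using A by (simp add: pos_divide_le_eq mult.commute)
qed

lemma hyperbolic_domain_of_omitted_pair:
  assumes dom: "planar_domain \<Omega>" and ab: "a \<notin> \<Omega>" "b \<notin> \<Omega>" "a \<noteq> b"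
  shows "hyperbolic_domain \<Omega>"
  unfolding hyperbolic_domain_def
proof (intro conjI ballI impI)
  show "planar_domain \<Omega>" by (fact dom)
  fix z w assume zw: "z \<in> \<Omega>" "w \<in> \<Omega>" "kobayashi_dist \<Omega> z w = 0"
  define s where "s = norm (b - a)"
  \<comment> \<open>The triangle inequality through \<open>w\<close> puts every point of the ball of
    radius \<open>dist z w\<close> around \<open>w\<close> within \<open>r * s\<close> of
    \<open>a\<close>, so the single pair \<open>a\<close>, \<open>b\<close> serves
    everywhere.\<close>
  define r where "r = (dist z w + dist w a) / s"
  have s: "s > 0" using ab by (simp add: s_def)
  have "dist z w / (8 * schottky_bound r * s) \<le> kobayashi_dist \<Omega> z w"
  proof (rule le_kobayashi_dist[OF dom zw(1,2)])
    fix \<zeta> assume "dist \<zeta> w < dist z w"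
    then have "norm (\<zeta> - a) \<le> r * norm (b - a)"
      using s dist_triangle[of \<zeta> a w] by (simp add: r_def s_def dist_norm)
    then show "\<exists>p q. p \<notin> \<Omega> \<and> q \<notin> \<Omega> \<and> p \<noteq> q \<and> norm (q - p) \<le> s \<and> norm (\<zeta> - p) \<le> r * norm (q - p)"
      using ab s_def by blast
  qed (use s in auto)
  moreover have "8 * schottky_bound r * s > 0"
    using s schottky_bound_pos by simp
  ultimately show "z = w"
    using zw(3) by (simp add: divide_le_0_iff)
qed

section \<open>The dust and its complement\<close>

text \<open>Powers of 2 make every coarser scale a multiple of every finer one. The square makes the
  ratios of consecutive scales unbounded.\<close>

definition scale :: "nat \<Rightarrow> real" where
  "scale n = 1 / 2 ^ ((n + 1)\<^sup>2)"

text \<open>Only levels below \<open>n\<close> are tested: \<open>survives 0\<close> is vacuous, and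
  a cell of side \<open>scale n\<close> has not yet been cut by its own level.\<close>

definition survives :: "nat \<Rightarrow> real \<Rightarrow> bool" where
  "survives n x \<longleftrightarrow> (\<forall>m<n. \<forall>k::int. scale (Suc m) \<le> \<bar>x - of_int k * scale m\<bar>)"

definition dust :: "real set" where
  "dust = {x. \<forall>n. survives n x}"

definition planar_dust :: "complex set" where
  "planar_dust = {z. Re z \<in> dust \<and> Im z \<in> dust}"

lemma scale_pos [simp]: "scale n > 0"
  by (simp add: scale_def)

lemma scale_nonneg [simp]: "scale n \<ge> 0" and scale_nonzero [simp]: "scale n \<noteq> 0"
  using scale_pos[of n] by linarith+

lemma scale_Suc: "scale n = 2 ^ (2 * n + 3) * scale (Suc n)"
proof -
  have "(Suc n + 1)\<^sup>2 = (n + 1)\<^sup>2 + (2 * n + 3)"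
    by (simp add: power2_eq_square algebra_simps)
  then show ?thesis
    by (simp add: scale_def power_add)
qed

lemma scale_multiple:
  assumes "m \<le> n"
  obtains j where "scale m = 2 ^ j * scale n"
proof -
  have "(m + 1)\<^sup>2 \<le> (n + 1)\<^sup>2"
    using assms by (simp add: power_mono)
  then have "scale m = 2 ^ ((n + 1)\<^sup>2 - (m + 1)\<^sup>2) * scale n"
    by (simp add: scale_def power_diff)
  then show ?thesis by (rule that)
qed

lemma scale_Suc_le: "8 * scale (Suc n) \<le> scale n"
proof -
  have "(2::real) ^ 3 \<le> 2 ^ (2 * n + 3)" by (intro power_increasing) auto
  then show ?thesis by (simp add: scale_Suc[of n])
qed

lemma scale_tendsto_0: "scale \<longlonglongrightarrow> 0"
proof (rule real_tendsto_sandwich)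
  show "\<forall>\<^sub>F n in sequentially. 0 \<le> scale n"
    by (simp add: less_imp_le)
  show "\<forall>\<^sub>F n in sequentially. scale n \<le> (1 / 2) ^ n"
  proof (intro always_eventually allI)
    fix n :: nat
    have "n \<le> (n + 1)\<^sup>2" by (simp add: power2_eq_square)
    then show "scale n \<le> (1 / 2) ^ n"
      by (simp add: scale_def power_one_over divide_simps)
  qed
qed (auto intro!: LIMSEQ_realpow_zero)

lemma scale_tendsto_small:
  assumes "e > 0"
  obtains n where "scale n < e"
  using order_tendstoD(2)[OF scale_tendsto_0 assms] by (auto simp: eventually_sequentially)

lemma closed_dust: "closed dust"
proof -
  have "dust = (\<Inter>n. \<Inter>k::int. {x. scale (Suc n) \<le> \<bar>x - of_int k * scale n\<bar>})"
    by (auto simp: dust_def survives_def)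
  moreover have "closed (\<Inter>n. \<Inter>k::int. {x. scale (Suc n) \<le> \<bar>x - of_int k * scale n\<bar>})"
    by (intro closed_INT ballI closed_Collect_le continuous_intros)
  ultimately show ?thesis by simp
qed

lemma scale_le_dist_dust:
  assumes "x \<in> dust"
  shows "scale (Suc n) \<le> \<bar>x - of_int k * scale n\<bar>"
  using assms by (auto simp: dust_def survives_def)

text \<open>Hence all grid lines lie in the domain. They show that the domain is dense and carry the
  sides of the separating boxes.\<close>

lemma multiple_notin_dust: "of_int k * scale n \<notin> dust"
  using scale_le_dist_dust[of "of_int k * scale n" n k] scale_pos[of "Suc n"] by (auto simp: not_le)

text \<open>The bound in \<open>survives\<close> is itself a multiple of every finer scale, so a cell of level \<open>n\<close>
  is removed up to level \<open>n\<close> either completely or not at all.\<close>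

lemma survives_cell:
  assumes surv: "survives n x"
    and x: "of_int k * scale n < x" "x < of_int (k + 1) * scale n"
    and y: "of_int k * scale n \<le> y" "y \<le> of_int (k + 1) * scale n"
  shows "survives n y"
  unfolding survives_def
proof (intro allI impI)
  fix m and k' :: int assume m: "m < n"
  obtain i where i: "scale m = 2 ^ i * scale n" using scale_multiple[of m n] m by auto
  obtain j where j: "scale (Suc m) = 2 ^ j * scale n" using scale_multiple[of "Suc m" n] m by auto
  have "scale (Suc m) \<le> \<bar>x - of_int k' * scale m\<bar>"
    using surv m by (auto simp: survives_def)
  then consider "of_int (k' * 2 ^ i + 2 ^ j) * scale n \<le> x"
    | "x \<le> of_int (k' * 2 ^ i - 2 ^ j) * scale n"
    unfolding i j by (fastforce simp: algebra_simps abs_if split: if_splits)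
  then show "scale (Suc m) \<le> \<bar>y - of_int k' * scale m\<bar>"
  proof cases
    case 1
    then have "of_int (k' * 2 ^ i + 2 ^ j) * scale n < of_int (k + 1) * scale n"
      using x by linarith
    \<comment> \<open>Both sides are multiples of \<open>scale n\<close>, so the strict inequality
      becomes one between integers and the whole cell lies beyond the removed interval.\<close>
    then have "k' * 2 ^ i + 2 ^ j \<le> k"
      unfolding mult_less_cancel_right_pos[OF scale_pos] of_int_less_iff by linarith
    then have "of_int (k' * 2 ^ i + 2 ^ j) * scale n \<le> of_int k * scale n"
      by (intro mult_right_mono) (simp_all only: of_int_le_iff scale_nonneg)
    then show ?thesis using y unfolding i j by (simp add: algebra_simps)
  next
    case 2
    then have "of_int k * scale n < of_int (k' * 2 ^ i - 2 ^ j) * scale n"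
      using x by linarith
    then have "k + 1 \<le> k' * 2 ^ i - 2 ^ j"
      unfolding mult_less_cancel_right_pos[OF scale_pos] of_int_less_iff by linarith
    then have "of_int (k + 1) * scale n \<le> of_int (k' * 2 ^ i - 2 ^ j) * scale n"
      by (intro mult_right_mono) (simp_all only: of_int_le_iff scale_nonneg)
    then show ?thesis using y unfolding i j by (simp add: algebra_simps)
  qed
qed

text \<open>The cell comes from rounding down. The inequalities are strict because grid points are
  not dust, and this strictness is what \<open>survives_cell\<close> asks for.\<close>

lemma dust_cell:
  assumes "x \<in> dust"
  obtains k where "of_int k * scale n < x" "x < of_int (k + 1) * scale n"
    "\<And>y. \<lbrakk>of_int k * scale n \<le> y; y \<le> of_int (k + 1) * scale n\<rbrakk> \<Longrightarrow> survives n y"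
proof
  define k where "k = \<lfloor>x / scale n\<rfloor>"
  have "of_int k \<le> x / scale n" "x / scale n < of_int (k + 1)"
    unfolding k_def by linarith+
  then have "of_int k * scale n \<le> x" and b: "x < of_int (k + 1) * scale n"
    by (simp_all only: pos_le_divide_eq[OF scale_pos] pos_divide_less_eq[OF scale_pos])
  moreover have "of_int k * scale n \<noteq> x" using assms multiple_notin_dust by metis
  ultimately show a: "of_int k * scale n < x" by simp
  show "x < of_int (k + 1) * scale n" by (fact b)
  show "survives n y" if "of_int k * scale n \<le> y" "y \<le> of_int (k + 1) * scale n" for y
    using survives_cell[OF _ a b that] assms by (simp add: dust_def)
qed

text \<open>A third of a level-\<open>n\<close> cell never comes close to a multiple of a finer scale, because
  \<open>3\<close> does not divide a power of \<open>2\<close>.\<close>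

lemma third_in_dust:
  assumes surv: "survives n x" and x: "x = of_int t / 3 * scale n" and t: "\<not> 3 dvd t"
  shows "x \<in> dust"
  unfolding dust_def survives_def
proof (intro CollectI allI impI)
  fix N m and k :: int
  show "scale (Suc m) \<le> \<bar>x - of_int k * scale m\<bar>"
  proof (cases "m < n")
    case True
    then show ?thesis using surv by (auto simp: survives_def)
  next
    case False
    then obtain j where j: "scale n = 2 ^ j * scale m" using scale_multiple[of n m] by auto
    have "\<not> (3::int) dvd 2 ^ j"
      using prime_dvd_power[of "3::int" 2 j] by auto
    then have "\<not> 3 dvd t * 2 ^ j"
      using t prime_dvd_mult_iff[of "3::int" t "2 ^ j"] by auto
    then have "t * 2 ^ j - 3 * k \<noteq> 0" by (metis dvd_triv_left eq_iff_diff_eq_0)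
    then have "1 \<le> \<bar>t * 2 ^ j - 3 * k\<bar>" by linarith
    then have "(1::real) \<le> \<bar>of_int (t * 2 ^ j - 3 * k)\<bar>" by (metis of_int_1_le_iff of_int_abs)
    then have "1 / 3 * scale m \<le> \<bar>of_int (t * 2 ^ j - 3 * k)\<bar> / 3 * scale m"
      by (intro mult_right_mono) (auto simp: less_imp_le)
    also have "\<dots> = \<bar>of_int (t * 2 ^ j - 3 * k) / 3 * scale m\<bar>"
      using scale_pos[of m] by (simp only: abs_mult abs_divide abs_of_pos abs_numeral)
    also have "of_int (t * 2 ^ j - 3 * k) / 3 * scale m = x - of_int k * scale m"
      by (simp add: x j field_simps)
    \<comment> \<open>A third of \<open>scale m\<close> exceeds the removal radius
      \<open>scale (Suc m)\<close>, which is at most an eighth of \<open>scale m\<close>.\<close>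
    finally show ?thesis using scale_Suc_le[of m] scale_pos[of "Suc m"] by linarith
  qed
qed

text \<open>Level \<open>n\<close> removes from a surviving cell only its first and last subcells of
  side \<open>scale (Suc n)\<close>. Any other subcell survives, and its two third points are
  dust.\<close>

lemma dust_near_cell:
  assumes surv: "\<And>y. \<lbrakk>of_int k * scale n \<le> y; y \<le> of_int (k + 1) * scale n\<rbrakk> \<Longrightarrow> survives n y"
    and x: "of_int k * scale n \<le> x" "x \<le> of_int (k + 1) * scale n"
  obtains y where "y \<in> dust" "y + scale (Suc n) / 3 \<in> dust" "\<bar>x - y\<bar> \<le> 4 * scale (Suc n)"
proof
  let ?s = "scale (Suc n)"
  define P :: int where "P = 2 ^ (2 * n + 3)"
  have P: "scale n = of_int P * ?s" by (simp add: P_def scale_Suc[of n])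
  have "(2::int) ^ 3 \<le> P" unfolding P_def by (intro power_increasing) auto
  then have P8: "P \<ge> 8" by simp
  define j0 where "j0 = \<lfloor>x / ?s\<rfloor>"
  \<comment> \<open>Clamping the subcell index away from the first and last subcell moves it by at
    most 2; the worst case is \<open>x\<close> at the right end, where
    \<open>j0 = k * P + P\<close>.\<close>
  define j where "j = max (k * P + 1) (min j0 (k * P + P - 2))"
  have xs: "of_int (k * P) \<le> x / ?s" "x / ?s \<le> of_int (k * P + P)"
    using x unfolding P by (simp_all add: field_simps)
  have j0: "k * P \<le> j0" "j0 \<le> k * P + P"
    using xs unfolding j0_def by linarith+
  then have jj: "\<bar>j0 - j\<bar> \<le> 2" "k * P + 1 \<le> j" "j + 1 \<le> k * P + P - 1"
    using P8 by (auto simp: j_def)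
  have xj: "\<bar>x / ?s - of_int j\<bar> \<le> 3"
  proof -
    have "of_int j0 \<le> x / ?s" "x / ?s \<le> of_int j0 + 1" unfolding j0_def by linarith+
    moreover have "\<bar>real_of_int j0 - of_int j\<bar> \<le> 2" using jj(1) by linarith
    ultimately show ?thesis by linarith
  qed
  have surv': "survives (Suc n) y" if y: "of_int j * ?s \<le> y" "y \<le> of_int (j + 1) * ?s" for y
  proof -
    have "of_int (k * P + 1) * ?s \<le> of_int j * ?s" "of_int (j + 1) * ?s \<le> of_int (k * P + P - 1) * ?s"
      using jj by (intro mult_right_mono; simp only: of_int_le_iff scale_nonneg)+
    then have y': "of_int k * scale n + ?s \<le> y" "y \<le> of_int (k + 1) * scale n - ?s"
      using y unfolding P by (simp_all add: algebra_simps)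
    have "?s \<le> \<bar>y - of_int k' * scale n\<bar>" for k' :: int
    proof (cases "k' \<le> k")
      case True
      then have "of_int k' * scale n \<le> of_int k * scale n"
        by (intro mult_right_mono) (simp_all add: less_imp_le)
      then show ?thesis using y' by linarith
    next
      case False
      then have "k + 1 \<le> k'" by simp
      then have "of_int (k + 1) * scale n \<le> of_int k' * scale n"
        by (intro mult_right_mono) (simp_all only: of_int_le_iff scale_nonneg)
      then show ?thesis using y' by linarith
    qed
    moreover have "survives n y"
      using y' scale_pos[of "Suc n"] by (intro surv) linarith+
    ultimately show ?thesis by (auto simp: survives_def less_Suc_eq)
  qed
  have dust: "of_int (3 * j + c) / 3 * ?s \<in> dust" if "c \<in> {1, 2}" for c :: int
  proof (rule third_in_dust)
    have "real_of_int j \<le> of_int (3 * j + c) / 3" "of_int (3 * j + c) / 3 \<le> real_of_int (j + 1)"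
      using that by auto
    then show "survives (Suc n) (of_int (3 * j + c) / 3 * ?s)"
      by (intro surv' mult_right_mono) (auto simp: less_imp_le)
    show "\<not> 3 dvd 3 * j + c" using that by auto presburger+
  qed auto
  let ?y = "of_int (3 * j + 1) / 3 * ?s"
  show "?y \<in> dust" using dust[of 1] by simp
  have "?y + ?s / 3 = of_int (3 * j + 2) / 3 * ?s" by (simp add: field_simps)
  then show "?y + ?s / 3 \<in> dust" using dust[of 2] by (simp only: insert_iff simp_thms)
  have "x - ?y = (x / ?s - of_int (3 * j + 1) / 3) * ?s"
    using scale_pos[of "Suc n"] by (simp add: left_diff_distrib)
  moreover have "\<bar>x / ?s - of_int (3 * j + 1) / 3\<bar> \<le> 4"
    using xj by (simp add: add_divide_distrib)
  ultimately show "\<bar>x - ?y\<bar> \<le> 4 * ?s"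
    by (simp add: abs_mult)
qed

section \<open>The complement as a dense hyperbolic domain\<close>

lemma closed_planar_dust: "closed planar_dust"
proof -
  have "planar_dust = Re -` dust \<inter> Im -` dust" by (auto simp: planar_dust_def)
  moreover have "closed (Re -` dust \<inter> Im -` dust)"
    by (intro closed_Int continuous_closed_vimage closed_dust) (auto intro: continuous_intros)
  ultimately show ?thesis by simp
qed

lemma zero_notin_dust: "0 \<notin> dust"
  using multiple_notin_dust[of 0 0] by simp

text \<open>A point outside the dust has a coordinate outside \<open>dust\<close>, so the vertical
  or horizontal line through it lies in the domain. That line meets the real or imaginary axis,
  which lies in the domain too because 0 is not in \<open>dust\<close>.\<close>

lemma planar_domain_Compl_planar_dust: "planar_domain (- planar_dust)"
  unfolding planar_domain_def
proof (intro conjI)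
  show "open (- planar_dust)" using closed_planar_dust by auto
  have "0 \<in> - planar_dust" using zero_notin_dust by (simp add: planar_dust_def)
  then show "- planar_dust \<noteq> {}" by blast
  have vert: "convex {z. Re z = c}" and hor: "convex {z. Im z = c}" for c
    by (auto simp: convex_def simp flip: distrib_right)
  have "connected_component (- planar_dust) 0 z" if z: "z \<in> - planar_dust" for z
  proof (cases "Re z \<in> dust")
    case False
    have "of_real (Re z) \<in> {w. Re w = Re z} \<inter> {w. Im w = 0}" by simp
    then have "connected ({w. Re w = Re z} \<union> {w. Im w = 0})"
      using vert hor by (intro connected_Un convex_connected) blast+
    then show ?thesis
      using False zero_notin_dust by (auto simp: planar_dust_def connected_component_def)
  next
    case True
    then have "Im z \<notin> dust" using z by (simp add: planar_dust_def)
    have "Complex 0 (Im z) \<in> {w. Im w = Im z} \<inter> {w. Re w = 0}" by simp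
    then have "connected ({w. Im w = Im z} \<union> {w. Re w = 0})"
      using vert hor by (intro connected_Un convex_connected) blast+
    then show ?thesis
      using \<open>Im z \<notin> dust\<close> zero_notin_dust by (auto simp: planar_dust_def connected_component_def)
  qed
  then show "connected (- planar_dust)"
    unfolding connected_iff_connected_component
    by (meson connected_component_sym connected_component_trans)
qed

lemma closure_Compl_planar_dust: "closure (- planar_dust) = UNIV"
proof -
  have "z \<in> closure (- planar_dust)" for z
    unfolding closure_approachable
  proof (intro allI impI)
    fix e :: real assume "e > 0"
    then obtain n where n: "scale n < e" by (rule scale_tendsto_small)
    define k where "k = \<lfloor>Re z / scale n\<rfloor>"
    have "\<bar>of_int k - Re z / scale n\<bar> \<le> 1" unfolding k_def by linarith
    then have "\<bar>of_int k - Re z / scale n\<bar> * scale n \<le> 1 * scale n"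
      by (intro mult_right_mono) (auto simp: less_imp_le)
    also have "\<bar>of_int k - Re z / scale n\<bar> * scale n = \<bar>(of_int k - Re z / scale n) * scale n\<bar>"
      using scale_pos[of n] by (simp only: abs_mult abs_of_pos)
    also have "(of_int k - Re z / scale n) * scale n = of_int k * scale n - Re z"
      using scale_pos[of n] by (simp add: left_diff_distrib)
    finally have "dist (Complex (of_int k * scale n) (Im z)) z < e"
      using n by (simp add: dist_norm cmod_def)
    then show "\<exists>w\<in>- planar_dust. dist w z < e"
      using multiple_notin_dust[of k n]
      by (intro bexI[of _ "Complex (of_int k * scale n) (Im z)"]) (auto simp: planar_dust_def)
  qed
  then show ?thesis by blast
qed

lemma third_pair_in_dust: "1 / 3 * scale 0 \<in> dust" "2 / 3 * scale 0 \<in> dust"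
  using third_in_dust[of 0 "1 / 3 * scale 0" 1] third_in_dust[of 0 "2 / 3 * scale 0" 2]
  by (simp_all add: survives_def)

lemma hyperbolic_Compl_planar_dust: "hyperbolic_domain (- planar_dust)"
proof (rule hyperbolic_domain_of_omitted_pair[OF planar_domain_Compl_planar_dust])
  let ?a = "Complex (1 / 3 * scale 0) (1 / 3 * scale 0)"
  let ?b = "Complex (2 / 3 * scale 0) (1 / 3 * scale 0)"
  show "?a \<notin> - planar_dust" "?b \<notin> - planar_dust"
    using third_pair_in_dust by (simp_all add: planar_dust_def)
  show "?a \<noteq> ?b" using scale_pos[of 0] by simp
qed

section \<open>Failure of logarithmic growth\<close>

lemma planar_dust_near_cell:
  assumes surv_x: "\<And>y. \<lbrakk>of_int k * scale n \<le> y; y \<le> of_int (k + 1) * scale n\<rbrakk> \<Longrightarrow> survives n y"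
    and surv_y: "\<And>y. \<lbrakk>of_int l * scale n \<le> y; y \<le> of_int (l + 1) * scale n\<rbrakk> \<Longrightarrow> survives n y"
    and re: "of_int k * scale n \<le> Re z" "Re z \<le> of_int (k + 1) * scale n"
    and im: "of_int l * scale n \<le> Im z" "Im z \<le> of_int (l + 1) * scale n"
  obtains a b where "a \<in> planar_dust" "b \<in> planar_dust" "norm (b - a) = scale (Suc n) / 3"
    "norm (z - a) \<le> 8 * scale (Suc n)"
proof -
  obtain x where x: "x \<in> dust" "x + scale (Suc n) / 3 \<in> dust" "\<bar>Re z - x\<bar> \<le> 4 * scale (Suc n)"
    using dust_near_cell[OF surv_x re] by metis
  obtain y where y: "y \<in> dust" "\<bar>Im z - y\<bar> \<le> 4 * scale (Suc n)"
    using dust_near_cell[OF surv_y im] by metis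
  show ?thesis
  \<comment> \<open>The pair differs only horizontally; the bound 8 adds the coordinate errors 4 and
    4.\<close>
  proof (rule that[of "Complex x y" "Complex (x + scale (Suc n) / 3) y"])
    show "norm (Complex (x + scale (Suc n) / 3) y - Complex x y) = scale (Suc n) / 3"
      using scale_pos[of "Suc n"] by (simp add: cmod_def)
    show "norm (z - Complex x y) \<le> 8 * scale (Suc n)"
      using cmod_le[of "z - Complex x y"] x y by simp
  qed (use x y in \<open>simp_all add: planar_dust_def\<close>)
qed

lemma planar_dust_frontier: "frontier (- planar_dust) \<subseteq> planar_dust"
  using closed_planar_dust by (simp add: frontier_complement frontier_subset_closed)

lemma kobayashi_dist_planar_dust_large:
  assumes p: "p \<in> planar_dust"
  obtains z where "z \<in> - planar_dust" "dist z p \<le> scale n"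
    "\<And>q. q \<in> planar_dust \<Longrightarrow> scale (Suc (Suc n)) \<le> dist z q"
    "4 ^ n / (2 * schottky_bound 24) \<le> kobayashi_dist (- planar_dust) 0 z"
proof -
  obtain k where k: "of_int k * scale n < Re p" "Re p < of_int (k + 1) * scale n"
    "\<And>y. \<lbrakk>of_int k * scale n \<le> y; y \<le> of_int (k + 1) * scale n\<rbrakk> \<Longrightarrow> survives n y"
    using p dust_cell[of "Re p" n] by (auto simp: planar_dust_def)
  obtain l where l: "of_int l * scale n < Im p" "Im p < of_int (l + 1) * scale n"
    "\<And>y. \<lbrakk>of_int l * scale n \<le> y; y \<le> of_int (l + 1) * scale n\<rbrakk> \<Longrightarrow> survives n y"
    using p dust_cell[of "Im p" n] by (auto simp: planar_dust_def)
  define z where "z = Complex ((of_int k + 1 / 2) * scale n) ((of_int l + 1 / 2) * scale n)"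
  \<comment> \<open>The centre is on a grid line of level \<open>Suc n\<close>, which yields both
    that it lies in the domain and its distance \<open>scale (Suc (Suc n))\<close> from the
    dust.\<close>
  have half: "Re z = of_int ((2 * k + 1) * 2 ^ (2 * n + 2)) * scale (Suc n)"
    by (simp add: z_def scale_Suc[of n] power_add field_simps)
  have "Re z \<notin> dust" unfolding half by (rule multiple_notin_dust)
  then have z: "z \<in> - planar_dust" by (simp add: planar_dust_def)
  have z_cell: "Re z = of_int k * scale n + scale n / 2" "Re z = of_int (k + 1) * scale n - scale n / 2"
    "Im z = of_int l * scale n + scale n / 2" "Im z = of_int (l + 1) * scale n - scale n / 2"
    by (simp_all add: z_def field_simps)
  have "\<bar>Re (z - p)\<bar> \<le> scale n / 2" "\<bar>Im (z - p)\<bar> \<le> scale n / 2"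
    using k(1,2) l(1,2) z_cell unfolding minus_complex.sel by linarith+
  then have near: "dist z p \<le> scale n"
    using cmod_le[of "z - p"] by (simp add: dist_norm)
  have far: "scale (Suc (Suc n)) \<le> dist z q" if "q \<in> planar_dust" for q
  proof -
    have "scale (Suc (Suc n)) \<le> \<bar>Re q - Re z\<bar>"
      unfolding half using that by (intro scale_le_dist_dust) (simp add: planar_dust_def)
    also have "\<dots> \<le> norm (z - q)"
      using abs_Re_le_cmod[of "z - q"] by (simp add: abs_minus_commute)
    finally show ?thesis by (simp add: dist_norm)
  qed
  \<comment> \<open>The radius is the inradius of the square, and 24 is the ratio of the distance
    \<open>8 * scale (Suc n)\<close> to the gap \<open>scale (Suc n) / 3\<close>.\<close>
  have "scale n / 2 / (8 * schottky_bound 24 * scale (Suc n)) \<le> kobayashi_dist (- planar_dust) 0 z"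
  proof (rule le_kobayashi_dist[OF planar_domain_Compl_planar_dust _ z])
    show "0 \<in> - planar_dust" using zero_notin_dust by (simp add: planar_dust_def)
    show "scale n / 2 \<le> dist 0 z"
    proof -
      \<comment> \<open>0 is a multiple of \<open>scale n\<close>, so it is not inside the vertical
        strip of which \<open>Re z\<close> is the middle.\<close>
      have "scale n / 2 \<le> \<bar>Re z\<bar>"
      proof (cases "k \<ge> 0")
        case True
        then have "0 \<le> of_int k * scale n" by (simp add: less_imp_le)
        then show ?thesis using z_cell(1) by linarith
      next
        case False
        then have "of_int (k + 1) * scale n \<le> 0"
          by (intro mult_nonpos_nonneg) (auto simp: less_imp_le)
        then show ?thesis using z_cell(2) by linarith
      qed
      then show ?thesis using abs_Re_le_cmod[of z] by simp
    qed
    fix \<zeta> assume "dist \<zeta> z < scale n / 2"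
    then have "\<bar>Re \<zeta> - Re z\<bar> < scale n / 2" "\<bar>Im \<zeta> - Im z\<bar> < scale n / 2"
      using abs_Re_le_cmod[of "\<zeta> - z"] abs_Im_le_cmod[of "\<zeta> - z"] by (auto simp: dist_norm)
    then have "of_int k * scale n \<le> Re \<zeta>" "Re \<zeta> \<le> of_int (k + 1) * scale n"
      "of_int l * scale n \<le> Im \<zeta>" "Im \<zeta> \<le> of_int (l + 1) * scale n"
      using z_cell by linarith+
    then obtain a b where "a \<in> planar_dust" "b \<in> planar_dust" "norm (b - a) = scale (Suc n) / 3"
      "norm (\<zeta> - a) \<le> 8 * scale (Suc n)"
      using planar_dust_near_cell[of k n l \<zeta>] k(3) l(3) by metis
    then show "\<exists>a b. a \<notin> - planar_dust \<and> b \<notin> - planar_dust \<and> a \<noteq> b \<and>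
        norm (b - a) \<le> scale (Suc n) \<and> norm (\<zeta> - a) \<le> 24 * norm (b - a)"
      using scale_pos[of "Suc n"] by (intro exI[of _ a] exI[of _ b] conjI) (auto simp del: scale_pos)
  qed (auto simp: less_imp_le)
  also have "scale n / 2 / (8 * schottky_bound 24 * scale (Suc n)) = 4 ^ n / (2 * schottky_bound 24)"
  proof -
    have "(2::real) ^ (2 * n + 3) = 8 * 4 ^ n" by (simp add: power_add power_mult)
    then show ?thesis by (simp add: scale_Suc[of n])
  qed
  finally show ?thesis using that z near far by blast
qed

text \<open>Near \<open>p\<close> the distance from 0 grows at least like \<open>4 ^ n\<close>,
  whereas the second Goldilocks condition would allow only \<open>(n + 3)\<^sup>2\<close> up to
  constants.\<close>

lemma not_local_goldilocks_planar_dust: "\<not> local_goldilocks_point (- planar_dust) p"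
proof
  assume "local_goldilocks_point (- planar_dust) p"
  then obtain U where p: "p \<in> frontier (- planar_dust)" and U: "open U" "p \<in> U"
    and growth: "\<forall>z0\<in>- planar_dust. \<exists>C>0. \<exists>\<alpha>>0. \<forall>z\<in>U \<inter> - planar_dust.
      kobayashi_dist (- planar_dust) z0 z \<le> C + \<alpha> * ln (1 / bdry_dist (- planar_dust) z)"
    unfolding local_goldilocks_point_def by blast
  have "0 \<in> - planar_dust" using zero_notin_dust by (simp add: planar_dust_def)
  then obtain C \<alpha> where \<alpha>: "\<alpha> > 0" and bound: "\<forall>z\<in>U \<inter> - planar_dust.
      kobayashi_dist (- planar_dust) 0 z \<le> C + \<alpha> * ln (1 / bdry_dist (- planar_dust) z)"
    using bspec[OF growth, of 0] by blast
  obtain e where e: "e > 0" "ball p e \<subseteq> U" using U open_contains_ball by blast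
  define B where "B = 2 * schottky_bound 24"
  have B: "B > 0" using schottky_bound_pos by (simp add: B_def)
  have le: "4 ^ n \<le> B * (C + \<alpha> * (real n + 3)\<^sup>2)" if n: "scale n < e" for n
  proof -
    obtain z where z: "z \<in> - planar_dust" "dist z p \<le> scale n"
      "\<And>q. q \<in> planar_dust \<Longrightarrow> scale (Suc (Suc n)) \<le> dist z q"
      "4 ^ n / B \<le> kobayashi_dist (- planar_dust) 0 z"
      using kobayashi_dist_planar_dust_large[of p n] p planar_dust_frontier unfolding B_def by blast
    have "z \<in> U" using z(2) n e by (auto simp: dist_commute)
    have d: "scale (Suc (Suc n)) \<le> bdry_dist (- planar_dust) z"
    proof -
      \<comment> \<open>\<open>infdist\<close> to the empty set is 0, so a positive lower bound
        needs a frontier point.\<close>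
      have "frontier (- planar_dust) \<noteq> {}" using p by blast
      then show ?thesis
        using planar_dust_frontier z(3) by (auto simp: infdist_notempty intro!: cINF_greatest)
    qed
    have "0 < bdry_dist (- planar_dust) z"
      by (rule less_le_trans[OF scale_pos d])
    with d have "ln (1 / bdry_dist (- planar_dust) z) \<le> ln (1 / scale (Suc (Suc n)))"
      by (intro ln_mono divide_left_mono mult_pos_pos) simp_all
    also have "\<dots> = (real n + 3)\<^sup>2 * ln 2"
      by (simp add: scale_def ln_realpow add.commute)
    also have "\<dots> \<le> (real n + 3)\<^sup>2"
      using ln_2_less_1 by (simp add: mult_left_le)
    finally have "\<alpha> * ln (1 / bdry_dist (- planar_dust) z) \<le> \<alpha> * (real n + 3)\<^sup>2"
      using \<alpha> by (intro mult_left_mono) auto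
    moreover have "kobayashi_dist (- planar_dust) 0 z \<le> C + \<alpha> * ln (1 / bdry_dist (- planar_dust) z)"
      using bound \<open>z \<in> U\<close> z(1) by blast
    ultimately have "4 ^ n / B \<le> C + \<alpha> * (real n + 3)\<^sup>2"
      using z(4) by linarith
    then show ?thesis using B by (simp add: pos_divide_le_eq mult.commute)
  qed
  have "(\<lambda>n. B * (C + \<alpha> * (real n + 3)\<^sup>2) / 4 ^ n) \<longlonglongrightarrow> 0"
    by real_asymp
  then have "\<forall>\<^sub>F n in sequentially. B * (C + \<alpha> * (real n + 3)\<^sup>2) / 4 ^ n < 1"
    by (rule order_tendstoD) simp
  moreover have "\<forall>\<^sub>F n in sequentially. scale n < e"
    using scale_tendsto_0 e by (auto dest: order_tendstoD)
  ultimately have "\<forall>\<^sub>F n in sequentially. False"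
    by eventually_elim (use le in \<open>force simp: pos_divide_less_eq\<close>)
  then show False by simp
qed

section \<open>Visibility by separation\<close>

lemma exhaustion_absorbs_compact:
  assumes K: "exhaustion UNIV K" and D: "compact D"
  obtains m where "\<forall>j\<ge>m. D \<subseteq> K j"
proof -
  have int: "K j \<subseteq> interior (K (Suc j))" for j
    using K by (simp add: exhaustion_def)
  then have mono: "K i \<subseteq> K j" if "i \<le> j" for i j
    using lift_Suc_mono_le[of K i j] int interior_subset that by blast
  have "D \<subseteq> (\<Union>j. interior (K (Suc j)))"
    using K int by (fastforce simp: exhaustion_def)
  then obtain J where J: "finite J" "D \<subseteq> (\<Union>j\<in>J. interior (K (Suc j)))"
    using D by (elim compactE_image[of D UNIV "\<lambda>j. interior (K (Suc j))"]) auto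
  show ?thesis
  proof (rule that[of "Suc (Max (insert 0 J))"], intro allI impI)
    fix j assume j: "Suc (Max (insert 0 J)) \<le> j"
    have "K (Suc i) \<subseteq> K j" if "i \<in> J" for i
    proof (rule mono)
      have "i \<le> Max (insert 0 J)" using J that by (intro Max_ge) auto
      then show "Suc i \<le> j" using j by linarith
    qed
    then show "D \<subseteq> K j" using J(2) interior_subset by fast
  qed
qed

text \<open>The complement of a compact plane set has only one unbounded component. A bounded member
  of an end would lie in some \<open>K i\<close>, but a later member is contained in it and avoids
  \<open>K i\<close>.\<close>

lemma ends_unique:
  assumes cl: "closure \<Omega> = UNIV" and K: "exhaustion UNIV K"
    and FG: "F \<in> ends \<Omega> K" "G \<in> ends \<Omega> K"
  shows "F = G"
proof -
  have comp: "H j \<in> components (- K j)" and unbdd: "\<not> bounded (H j)" if H: "H \<in> ends \<Omega> K" for H j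
  proof -
    have comps: "H j \<in> components (- K j)" and Suc: "H (Suc j) \<subseteq> H j" for j
      using H cl by (auto simp: ends_def Compl_eq_Diff_UNIV split: if_splits)
    show "H j \<in> components (- K j)" by (fact comps)
    show "\<not> bounded (H j)"
    proof
      assume "bounded (H j)"
      then have "compact (closure (H j))" by (simp only: compact_closure)
      then obtain m where m: "\<forall>i\<ge>m. closure (H j) \<subseteq> K i"
        by (rule exhaustion_absorbs_compact[OF K])
      have "H (max m j) \<subseteq> H j" using Suc by (rule lift_Suc_antimono_le) simp
      also have "\<dots> \<subseteq> K (max m j)" using m closure_subset[of "H j"] by (meson max.cobounded1 order_trans)
      finally show False
        using in_components_subset[OF comps] in_components_nonempty[OF comps, of "max m j"] by blast
    qed
  qed
  show ?thesis
  proof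
    fix j
    have "bounded (- (- K j))" using K by (simp add: exhaustion_def compact_imp_bounded)
    then show "F j = G j"
      using comp[OF FG(1)] comp[OF FG(2)] unbdd[OF FG(1)] unbdd[OF FG(2)]
      by (intro cobounded_unique_unbounded_components) auto
  qed
qed

section \<open>Separation in the end compactification\<close>

definition separated_by_compact ::
  "complex set \<Rightarrow> (nat \<Rightarrow> complex set) \<Rightarrow> end_point \<Rightarrow> end_point \<Rightarrow> bool" where
  "separated_by_compact \<Omega> K \<zeta> \<eta> \<longleftrightarrow>
     (\<exists>V W L. openin (end_compactification \<Omega> K) V \<and> \<zeta> \<in> V \<and>
        openin (end_compactification \<Omega> K) W \<and> \<eta> \<in> W \<and>
        (end_compactification \<Omega> K closure_of V) \<inter> (end_compactification \<Omega> K closure_of W) = {} \<and>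
        compact L \<and> L \<subseteq> \<Omega> \<and>
        (\<forall>S x y. connected S \<longrightarrow> x \<in> S \<longrightarrow> Pt x \<in> V \<longrightarrow> y \<in> S \<longrightarrow> Pt y \<in> W \<longrightarrow> S \<inter> L \<noteq> {}))"

text \<open>Separation speaks of connected sets instead of parametrised curves, so no reversal of an
  almost-geodesic is needed.\<close>

lemma separated_by_compact_sym:
  assumes "separated_by_compact \<Omega> K \<zeta> \<eta>"
  shows "separated_by_compact \<Omega> K \<eta> \<zeta>"
proof -
  obtain V W L where VWL: "openin (end_compactification \<Omega> K) V" "\<zeta> \<in> V"
        "openin (end_compactification \<Omega> K) W" "\<eta> \<in> W" "compact L" "L \<subseteq> \<Omega>"
    and disj: "(end_compactification \<Omega> K closure_of V) \<inter> (end_compactification \<Omega> K closure_of W) = {}"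
    and meets: "\<forall>S x y. connected S \<longrightarrow> x \<in> S \<longrightarrow> Pt x \<in> V \<longrightarrow> y \<in> S \<longrightarrow> Pt y \<in> W \<longrightarrow> S \<inter> L \<noteq> {}"
    using assms unfolding separated_by_compact_def by (elim exE conjE)
  have "(end_compactification \<Omega> K closure_of W) \<inter> (end_compactification \<Omega> K closure_of V) = {}"
    using disj by (simp only: Int_commute)
  moreover have "\<forall>S x y. connected S \<longrightarrow> x \<in> S \<longrightarrow> Pt x \<in> W \<longrightarrow> y \<in> S \<longrightarrow> Pt y \<in> V \<longrightarrow> S \<inter> L \<noteq> {}"
    using meets by simp
  ultimately show ?thesis
    unfolding separated_by_compact_def
    by (intro exI[of _ W] exI[of _ V] exI[of _ L] conjI VWL)
qed

lemma abs_continuous_on_imp_continuous_on: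
  assumes "abs_continuous_on {a..b} \<sigma>"
  shows "continuous_on {a..b} \<sigma>"
  unfolding continuous_on_iff
proof (intro ballI allI impI)
  fix x \<epsilon> :: real assume x: "x \<in> {a..b}" and "\<epsilon> > 0"
  then obtain \<delta> where \<delta>: "\<delta> > 0" and small: "\<forall>\<D>. \<D> division_of \<Union>\<D> \<and> \<Union>\<D> \<subseteq> {a..b} \<and>
      (\<Sum>J\<in>\<D>. Sup J - Inf J) < \<delta> \<longrightarrow> (\<Sum>J\<in>\<D>. norm (\<sigma> (Sup J) - \<sigma> (Inf J))) < \<epsilon>"
    using assms[unfolded abs_continuous_on_def, rule_format, of \<epsilon>] \<open>\<epsilon> > 0\<close> by blast
  have step: "dist (\<sigma> t) (\<sigma> s) < \<epsilon>" if "s \<in> {a..b}" "t \<in> {a..b}" "s \<le> t" "t - s < \<delta>" for s t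
    \<comment> \<open>A family consisting of one interval turns absolute continuity into uniform
      continuity.\<close>
    using small[rule_format, of "{{s..t}}"] division_of_self[of s t] that by (auto simp: dist_norm)
  show "\<exists>\<delta>>0. \<forall>y\<in>{a..b}. dist y x < \<delta> \<longrightarrow> dist (\<sigma> y) (\<sigma> x) < \<epsilon>"
  proof (intro exI[of _ \<delta>] conjI ballI impI \<delta>)
    fix y assume "y \<in> {a..b}" "dist y x < \<delta>"
    then show "dist (\<sigma> y) (\<sigma> x) < \<epsilon>"
      using step[of x y] step[of y x] x by (cases "x \<le> y") (auto simp: dist_real_def dist_commute)
  qed
qed

lemma visible_pair_of_separated_by_compact:
  assumes "separated_by_compact \<Omega> K \<zeta> \<eta>"
  shows "visible_pair \<Omega> K lam kap \<zeta> \<eta>"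
proof -
  obtain V W L where VW: "openin (end_compactification \<Omega> K) V" "\<zeta> \<in> V"
        "openin (end_compactification \<Omega> K) W" "\<eta> \<in> W"
        "(end_compactification \<Omega> K closure_of V) \<inter> (end_compactification \<Omega> K closure_of W) = {}"
        "compact L" "L \<subseteq> \<Omega>"
    and meets: "\<And>S x y. \<lbrakk>connected S; x \<in> S; Pt x \<in> V; y \<in> S; Pt y \<in> W\<rbrakk> \<Longrightarrow> S \<inter> L \<noteq> {}"
    using assms unfolding separated_by_compact_def by blast
  have "\<sigma> ` {0..T} \<inter> L \<noteq> {}"
    if "0 \<le> T" "almost_geodesic \<Omega> lam kap {0..T} \<sigma>" "Pt (\<sigma> 0) \<in> V" "Pt (\<sigma> T) \<in> W" for T \<sigma>
  proof -
    have "connected (\<sigma> ` {0..T})"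
      using that(2) unfolding almost_geodesic_def
      by (intro connected_continuous_image abs_continuous_on_imp_continuous_on) auto
    then show ?thesis
      using that by (intro meets[of _ "\<sigma> 0" "\<sigma> T"]) auto
  qed
  then show ?thesis
    unfolding visible_pair_def using VW by blast
qed

lemma openin_Pt_image:
  assumes "open A" "A \<subseteq> closure \<Omega>"
  shows "openin (end_compactification \<Omega> K) (Pt ` A)"
  unfolding openin_end_compactification
proof (intro conjI allI impI)
  fix z assume "Pt z \<in> Pt ` A"
  then obtain e where "e > 0" "ball z e \<subseteq> A" using assms(1) open_contains_ball by blast
  then show "\<exists>e>0. Pt ` (ball z e \<inter> closure \<Omega>) \<subseteq> Pt ` A" by blast
qed (use assms(2) in auto)

text \<open>Compactness matters at the ends: \<open>D\<close> lies in some \<open>K m\<close>, so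
  the neighbourhood of an end given by its \<open>m\<close>-th member misses
  \<open>D\<close>.\<close>

lemma closedin_Pt_image:
  assumes cl: "closure \<Omega> = UNIV" and K: "exhaustion UNIV K" and D: "compact D"
  shows "closedin (end_compactification \<Omega> K) (Pt ` D)"
  unfolding closedin_def
proof
  let ?X = "end_compactification \<Omega> K"
  show "Pt ` D \<subseteq> topspace ?X" by (auto simp: topspace_end_compactification cl)
  obtain m where m: "D \<subseteq> K m" using exhaustion_absorbs_compact[OF K D] by (metis order_refl)
  show "openin ?X (topspace ?X - Pt ` D)"
    unfolding openin_end_compactification
  proof (intro conjI allI impI)
    fix z assume "Pt z \<in> topspace ?X - Pt ` D"
    then have "z \<in> - D" by blast
    then obtain e where "e > 0" "ball z e \<subseteq> - D"
      using D compact_imp_closed open_contains_ball[of "- D"] by blast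
    then show "\<exists>e>0. Pt ` (ball z e \<inter> closure \<Omega>) \<subseteq> topspace ?X - Pt ` D"
      by (intro exI[of _ e]) (auto simp: topspace_end_compactification cl)
  next
    fix F assume "End F \<in> topspace ?X - Pt ` D"
    then have "F \<in> ends \<Omega> K" by (auto simp: topspace_end_compactification)
    then have "F m \<subseteq> - K m"
      using in_components_subset[of "F m"] cl by (fastforce simp: ends_def split: if_splits)
    then show "\<exists>j. end_nbhd \<Omega> K F j \<subseteq> topspace ?X - Pt ` D"
      using m by (intro exI[of _ m]) (auto simp: end_nbhd_def topspace_end_compactification cl)
  qed (auto simp: topspace_end_compactification)
qed

text \<open>A connected set meeting both \<open>A\<close> and its complement meets
  \<open>frontier A\<close>. Taking a ball whose closure stays in \<open>A\<close> on one side and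
  the complement of \<open>closure A\<close> on the other keeps the two closures disjoint.\<close>

lemma separated_by_compact_of_frontier:
  assumes cl: "closure \<Omega> = UNIV" and K: "exhaustion UNIV K"
    and A: "open A" "bounded A" "a \<in> A" "frontier A \<subseteq> \<Omega>"
    and \<eta>: "\<eta> \<in> topspace (end_compactification \<Omega> K)" "\<eta> \<notin> Pt ` closure A"
  shows "separated_by_compact \<Omega> K (Pt a) \<eta>"
proof -
  let ?X = "end_compactification \<Omega> K"
  obtain e where e: "e > 0" "cball a e \<subseteq> A"
    using A open_contains_cball by blast
  define V where "V = Pt ` ball a e"
  define W where "W = topspace ?X - Pt ` closure A"
  have closed_cball: "closedin ?X (Pt ` cball a e)"
    using closedin_Pt_image[OF cl K] by simp
  have closed_W: "closedin ?X (topspace ?X - Pt ` A)"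
    using openin_Pt_image[OF A(1), of \<Omega> K] cl by (simp add: openin_closedin_eq)
  have "?X closure_of V \<subseteq> Pt ` cball a e"
    unfolding V_def using closed_cball by (intro closure_of_minimal) auto
  moreover have "?X closure_of W \<subseteq> topspace ?X - Pt ` A"
    unfolding W_def using closed_W closure_subset by (intro closure_of_minimal) auto
  moreover have "openin ?X V" unfolding V_def using cl by (intro openin_Pt_image) auto
  moreover have "openin ?X W"
    unfolding W_def using closedin_Pt_image[OF cl K, of "closure A"] A(2) by (auto simp: closedin_def compact_closure)
  moreover have "S \<inter> frontier A \<noteq> {}"
    if "connected S" "x \<in> S" "Pt x \<in> V" "y \<in> S" "Pt y \<in> W" for S x y
  proof (rule connected_Int_frontier[OF that(1)])
    show "S \<inter> A \<noteq> {}" using that subsetD[OF e(2), of x] by (auto simp: V_def)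
    show "S - A \<noteq> {}" using that closure_subset by (auto simp: W_def)
  qed
  moreover have "compact (frontier A)" using A(2) by (simp add: compact_frontier_bounded)
  moreover have "Pt a \<in> V" "\<eta> \<in> W" using e \<eta> by (auto simp: V_def W_def)
  ultimately show ?thesis
    unfolding separated_by_compact_def using e(2) A(4)
    by (intro exI[of _ V] exI[of _ W] exI[of _ "frontier A"]) blast
qed

text \<open>The box is the open grid cell of a small level around \<open>a\<close>; its sides lie on
  grid lines.\<close>

lemma planar_dust_small_box:
  assumes a: "a \<in> planar_dust" and e: "e > 0"
  obtains A where "open A" "a \<in> A" "closure A \<subseteq> ball a e" "frontier A \<subseteq> - planar_dust"
proof -
  obtain n where n: "scale n < e / 2" using scale_tendsto_small[of "e / 2"] e by auto
  obtain k where k: "of_int k * scale n < Re a" "Re a < of_int (k + 1) * scale n"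
    using a dust_cell[of "Re a" n] by (auto simp: planar_dust_def)
  obtain l where l: "of_int l * scale n < Im a" "Im a < of_int (l + 1) * scale n"
    using a dust_cell[of "Im a" n] by (auto simp: planar_dust_def)
  define p where "p = Complex (of_int k * scale n) (of_int l * scale n)"
  define q where "q = Complex (of_int (k + 1) * scale n) (of_int (l + 1) * scale n)"
  have a_in: "a \<in> box p q"
    using k l by (simp add: in_box_complex_iff p_def q_def)
  show ?thesis
  proof (rule that[of "box p q"])
    show "a \<in> box p q" by (fact a_in)
    have "z \<in> ball a e" if "z \<in> cbox p q" for z
    proof -
      have "\<bar>Re (a - z)\<bar> \<le> scale n" "\<bar>Im (a - z)\<bar> \<le> scale n"
        using that k l by (auto simp: in_cbox_complex_iff p_def q_def algebra_simps)
      then show ?thesis using cmod_le[of "a - z"] n by (simp add: dist_norm)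
    qed
    then show "closure (box p q) \<subseteq> ball a e" using a_in by (subst closure_box) auto
    have "z \<notin> planar_dust" if "z \<in> cbox p q - box p q" for z
    proof -
      have "Re z \<in> {of_int k * scale n, of_int (k + 1) * scale n} \<or>
        Im z \<in> {of_int l * scale n, of_int (l + 1) * scale n}"
        using that by (auto simp: in_cbox_complex_iff in_box_complex_iff p_def q_def)
      then show ?thesis
        using multiple_notin_dust[of _ n] by (metis (no_types, lifting) empty_iff insert_iff mem_Collect_eq planar_dust_def)
    qed
    then show "frontier (box p q) \<subseteq> - planar_dust" using a_in by (subst frontier_box) auto
  qed auto
qed

lemma separated_planar_dust:
  assumes K: "exhaustion UNIV K" and a: "a \<in> planar_dust"
    and \<eta>: "\<eta> \<in> topspace (end_compactification (- planar_dust) K)" "\<eta> \<noteq> Pt a"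
  shows "separated_by_compact (- planar_dust) K (Pt a) \<eta>"
proof -
  \<comment> \<open>Every ball works for an end; for a point \<open>b\<close>, the open ball of
    radius \<open>dist a b\<close> just misses it.\<close>
  have "\<exists>e>0. \<eta> \<notin> Pt ` ball a e"
  proof (cases \<eta>)
    case (Pt b)
    then have "\<eta> \<notin> Pt ` ball a (dist a b)" by (simp add: image_iff)
    then show ?thesis using \<eta>(2) Pt by (intro exI[of _ "dist a b"]) simp
  next
    case (End F)
    then show ?thesis by (intro exI[of _ 1]) (simp add: image_iff)
  qed
  then obtain e where e: "e > 0" "\<eta> \<notin> Pt ` ball a e" by blast
  obtain A where A: "open A" "a \<in> A" "closure A \<subseteq> ball a e" "frontier A \<subseteq> - planar_dust"
    by (rule planar_dust_small_box[OF a e(1)])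
  have "bounded A"
    using A(3) closure_subset[of A] by (intro bounded_subset[OF bounded_ball[of a e]]) simp
  then show ?thesis
    using A e(2) \<eta>(1) by (intro separated_by_compact_of_frontier[OF closure_Compl_planar_dust K, of A]) auto
qed

lemma visibility_Compl_planar_dust: "visibility_domain (- planar_dust)"
  unfolding visibility_domain_def
proof (intro conjI hyperbolic_Compl_planar_dust allI impI ballI visible_pair_of_separated_by_compact)
  fix K \<zeta> \<eta>
  assume "exhaustion (closure (- planar_dust)) K"
    and \<zeta>: "\<zeta> \<in> end_boundary (- planar_dust) K" and \<eta>: "\<eta> \<in> end_boundary (- planar_dust) K"
    and ne: "\<zeta> \<noteq> \<eta>"
  then have K: "exhaustion UNIV K" by (simp add: closure_Compl_planar_dust)
  have top: "\<zeta> \<in> topspace (end_compactification (- planar_dust) K)"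
    "\<eta> \<in> topspace (end_compactification (- planar_dust) K)"
    using \<zeta> \<eta> by (auto simp: end_boundary_def)
  \<comment> \<open>Points of the end boundary that are not ends lie in the dust and have small
    boxes around them; two distinct ends cannot occur.\<close>
  consider a where "\<zeta> = Pt a" | a where "\<eta> = Pt a" | F G where "\<zeta> = End F" "\<eta> = End G"
    by (meson end_point.exhaust)
  then show "separated_by_compact (- planar_dust) K \<zeta> \<eta>"
  proof cases
    case 1
    then have "a \<in> planar_dust" using \<zeta> by (auto simp: end_boundary_def)
    then show ?thesis using separated_planar_dust[OF K _ top(2)] ne 1 by auto
  next
    case 2
    then have "a \<in> planar_dust" using \<eta> by (auto simp: end_boundary_def)
    then show ?thesis
      using separated_planar_dust[OF K _ top(1)] ne 2 by (auto intro: separated_by_compact_sym)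
  next
    case 3
    then have "F \<in> ends (- planar_dust) K" "G \<in> ends (- planar_dust) K"
      using \<zeta> \<eta> by (auto simp: end_boundary_def topspace_end_compactification)
    then show ?thesis using ends_unique[OF closure_Compl_planar_dust K] ne 3 by blast
  qed
qed

theorem mainTheorem10:
  shows "\<exists>\<Omega>. hyperbolic_domain \<Omega> \<and> visibility_domain \<Omega> \<and>
              (\<forall>p\<in>frontier \<Omega>. \<not> local_goldilocks_point \<Omega> p)"
  using hyperbolic_Compl_planar_dust visibility_Compl_planar_dust not_local_goldilocks_planar_dust
  by blast

end
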